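(* The following are equivalent: (i) two independent Bernoulli percolations on $\mathbb{Z}$ (with parameter $\frac12$) are rough isometric almost surely; (ii) two independent rooted Bernoulli percolations $(A,0)$ and $(B,0)$ on $\mathbb{N}$ are rooted rough isometric with positive probability.
   Context: A Bernoulli percolation on $\mathbb{Z}$ with parameter $\frac12$ is the random subset of $\mathbb{Z}$ obtained by independently deleting each integer with probability $\frac12$. A rooted Bernoulli percolation on $\mathbb{N}=\{1,2,\ldots\}$ is a random subset $A\subseteq\mathbb{N}\cup\{0\}$ in which $0\in A$ deterministically and each $n\in\mathbb{N}$ belongs to $A$ with probability $\frac12$, independently. Subsets of $\mathbb{R}$ are viewed as metric spaces with the metric inherited from $\mathbb{R}$. Two metric spaces $X,Y$ are rough isometric if there exist a mapping $T:X\to Y$ and constants $M>0$, $D,R\ge0$ such that: (i) for all $x_1,x_2\in X$, $\frac1M d_X(x_1,x_2)-D\le d_Y(T(x_1),T(x_2))\le M d_X(x_1,x_2)+D$; (ii) for every $y\in Y$ there is $x\in X$ with $d_Y(y,T(x))\le R$. Two rooted metric spaces $(X,a)$ and $(Y,b)$ are rooted rough isometric if there exist such $T$ and constants with, in addition, $T(a)=b$. *)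

theory Defs
  imports "HOL-Probability.Probability"
begin

text \<open>
  A metric space is represented by a subset of a type of class \<open>metric_space\<close>, with the
  inherited metric \<open>dist\<close>.
\<close>

definition rough_isometry ::
    "('a::metric_space \<Rightarrow> 'b::metric_space) \<Rightarrow> 'a set \<Rightarrow> 'b set \<Rightarrow> real \<Rightarrow> real \<Rightarrow> real \<Rightarrow> bool" where
  "rough_isometry T X Y M D R \<longleftrightarrow>
     T \<in> X \<rightarrow> Y \<and>
     (\<forall>x1\<in>X. \<forall>x2\<in>X.
        1 / M * dist x1 x2 - D \<le> dist (T x1) (T x2) \<and>
        dist (T x1) (T x2) \<le> M * dist x1 x2 + D) \<and>
     (\<forall>y\<in>Y. \<exists>x\<in>X. dist y (T x) \<le> R)"

definition rough_isometric :: "'a::metric_space set \<Rightarrow> 'b::metric_space set \<Rightarrow> bool" where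
  "rough_isometric X Y \<longleftrightarrow>
     (\<exists>T M D R. M > 0 \<and> D \<ge> 0 \<and> R \<ge> 0 \<and> rough_isometry T X Y M D R)"

definition rooted_rough_isometric ::
    "'a::metric_space set \<times> 'a \<Rightarrow> 'b::metric_space set \<times> 'b \<Rightarrow> bool" where
  "rooted_rough_isometric = (\<lambda>(X, a) (Y, b).
     \<exists>T M D R. M > 0 \<and> D \<ge> 0 \<and> R \<ge> 0 \<and> rough_isometry T X Y M D R \<and> T a = b)"

text \<open>
  A random subset of a countable set is a set-valued map on a probability space; its law and
  its independence properties are those of its membership indicators.
\<close>

definition bernoulli_percolation_Z :: "'w measure \<Rightarrow> ('w \<Rightarrow> int set) \<Rightarrow> bool" where
  "bernoulli_percolation_Z P A \<longleftrightarrow>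
     prob_space.indep_vars P (\<lambda>_. count_space (UNIV :: bool set)) (\<lambda>z \<omega>. z \<in> A \<omega>) UNIV \<and>
     (\<forall>z. measure P {\<omega> \<in> space P. z \<in> A \<omega>} = 1 / 2)"

definition rooted_bernoulli_percolation_N :: "'w measure \<Rightarrow> ('w \<Rightarrow> nat set) \<Rightarrow> bool" where
  "rooted_bernoulli_percolation_N P A \<longleftrightarrow>
     (\<forall>\<omega>\<in>space P. 0 \<in> A \<omega>) \<and>
     prob_space.indep_vars P (\<lambda>_. count_space (UNIV :: bool set)) (\<lambda>n \<omega>. n \<in> A \<omega>) {1..} \<and>
     (\<forall>n\<ge>1. measure P {\<omega> \<in> space P. n \<in> A \<omega>} = 1 / 2)"

definition independent_random_sets ::
    "'w measure \<Rightarrow> ('w \<Rightarrow> 'i set) \<Rightarrow> ('w \<Rightarrow> 'i set) \<Rightarrow> bool" where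
  "independent_random_sets P A B \<longleftrightarrow>
     prob_space.indep_var P
       (Pi\<^sub>M UNIV (\<lambda>_. count_space (UNIV :: bool set))) (\<lambda>\<omega> i. i \<in> A \<omega>)
       (Pi\<^sub>M UNIV (\<lambda>_. count_space (UNIV :: bool set))) (\<lambda>\<omega> i. i \<in> B \<omega>)"

end

theory Submission
  imports Defs
begin

text \<open>
  As the constants are not prescribed, rough isometry is unaffected by changing either space within
  bounded Hausdorff distance, and a root can be imposed afterwards. Hence the event that two
  rooted percolations are rough isometric is a tail event, of probability \<open>0\<close> or \<open>1\<close>; its
  measurability is a compactness argument. If it has probability \<open>1\<close>, then the positive halves of
  \<open>X\<close> and \<open>Y\<close>, and likewise the negative ones, are rough isometric, and rooted rough isometries glue at
  the origin. Conversely, almost surely the gaps of \<open>X\<close> near \<open>n\<close> have size \<open>o(n)\<close>, so a rough isometry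
  cannot jump between the two ends of \<open>Y\<close> far from the origin: the positive half of \<open>X\<close> is then rough
  isometric to the positive or to the negative half of \<open>Y\<close>. Both pairs have the law of \<open>(A, B)\<close>, whence
  the probability in (ii) is not \<open>0\<close>.
\<close>

section \<open>Rough isometries and bounded perturbations\<close>

text \<open>Finite Hausdorff distance. \<open>C\<close> carries no sign condition: a point of either
  set forces it to be nonnegative.\<close>

definition coarsely_equal :: "'a::metric_space set \<Rightarrow> 'a set \<Rightarrow> bool" where
  "coarsely_equal X Y \<longleftrightarrow>
     (\<exists>C. (\<forall>x\<in>X. \<exists>y\<in>Y. dist x y \<le> C) \<and> (\<forall>y\<in>Y. \<exists>x\<in>X. dist y x \<le> C))"

lemma coarsely_equal_sym: "coarsely_equal X Y \<Longrightarrow> coarsely_equal Y X"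
  unfolding coarsely_equal_def by blast

lemma coarsely_equal_refl: "coarsely_equal X X"
  unfolding coarsely_equal_def by (intro exI[of _ 0]) auto

text \<open>Every added point lies within the sum of the distances from \<open>F\<close> to
  \<open>x0\<close>. Finite changes to a percolation and the insertion of a root are both handled
  this way.\<close>

lemma coarsely_equal_Un_finite:
  assumes "finite F" and "x0 \<in> X"
  shows "coarsely_equal X (X \<union> F)"
proof -
  define C where "C = (\<Sum>f\<in>F. dist f x0)"
  have F: "dist f x0 \<le> C" if "f \<in> F" for f
    unfolding C_def using assms(1) that by (intro member_le_sum) auto
  have "C \<ge> 0" unfolding C_def by (simp add: sum_nonneg)
  then show ?thesis
    unfolding coarsely_equal_def
    by (intro exI[of _ C]) (use F assms(2) in \<open>force\<close>)
qed

lemma rough_isometry_mono: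
  assumes "rough_isometry T X Y M D R" "0 < M" "M \<le> M'" "D \<le> D'" "R \<le> R'"
  shows "rough_isometry T X Y M' D' R'"
proof -
  have "1 / M' * d - D' \<le> 1 / M * d - D" "M * d + D \<le> M' * d + D'" if "d \<ge> 0" for d :: real
  proof -
    have "1 / M' * d \<le> 1 / M * d"
      using assms that by (intro mult_right_mono frac_le) auto
    then show "1 / M' * d - D' \<le> 1 / M * d - D" using assms by linarith
    have "M * d \<le> M' * d" using assms that by (intro mult_right_mono)
    then show "M * d + D \<le> M' * d + D'" using assms by linarith
  qed
  then show ?thesis
    using assms unfolding rough_isometry_def
    by (meson order_trans zero_le_dist)
qed

text \<open>Triangle inequalities throughout. Passing through \<open>\<rho>\<close> changes source
  distances by at most \<open>2 * C\<close>, which after scaling costs \<open>2 * C * M\<close> or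
  \<open>2 * C / M\<close>; replacing \<open>T\<close> by \<open>T'\<close> changes target distances
  by at most \<open>2 * C\<close>.\<close>

lemma rough_isometry_perturb:
  assumes T: "rough_isometry T X Y M D R" and M: "M > 0"
    and \<rho>: "\<And>x. x \<in> X' \<Longrightarrow> \<rho> x \<in> X" "\<And>x. x \<in> X' \<Longrightarrow> dist x (\<rho> x) \<le> C"
    and X: "\<And>x. x \<in> X \<Longrightarrow> \<exists>x'\<in>X'. dist x x' \<le> C"
    and T': "T' \<in> X' \<rightarrow> Y'" "\<And>x. x \<in> X' \<Longrightarrow> dist (T' x) (T (\<rho> x)) \<le> C"
    and Y: "\<And>y. y \<in> Y' \<Longrightarrow> \<exists>y'\<in>Y. dist y y' \<le> C"
  shows "rough_isometry T' X' Y' M (D + 2 * C * M + 2 * C + 2 * C / M) (R + D + 2 * C * M + 2 * C)"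
proof -
  have Tb: "1 / M * dist x1 x2 - D \<le> dist (T x1) (T x2)"
           "dist (T x1) (T x2) \<le> M * dist x1 x2 + D" if "x1 \<in> X" "x2 \<in> X" for x1 x2
    using T that unfolding rough_isometry_def by auto
  show ?thesis
    unfolding rough_isometry_def
  proof (intro conjI ballI)
    show "T' \<in> X' \<rightarrow> Y'" by (rule T')
  next
    fix x1 x2 assume x: "x1 \<in> X'" "x2 \<in> X'"
    have C: "C \<ge> 0" using \<rho>(2)[OF x(1)] zero_le_dist[of x1 "\<rho> x1"] by linarith
    have "dist x1 x2 \<le> dist (\<rho> x1) (\<rho> x2) + 2 * C"
      using \<rho>(2)[OF x(1)] \<rho>(2)[OF x(2)] by metric
    then have "1 / M * dist x1 x2 \<le> 1 / M * (dist (\<rho> x1) (\<rho> x2) + 2 * C)"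
      using M by (intro mult_left_mono) auto
    moreover have "dist (\<rho> x1) (\<rho> x2) \<le> dist x1 x2 + 2 * C"
      using \<rho>(2)[OF x(1)] \<rho>(2)[OF x(2)] by metric
    then have "M * dist (\<rho> x1) (\<rho> x2) \<le> M * (dist x1 x2 + 2 * C)"
      using M by (intro mult_left_mono) auto
    moreover have "dist (T' x1) (T' x2) \<le> dist (T (\<rho> x1)) (T (\<rho> x2)) + 2 * C"
      using T'(2)[OF x(1)] T'(2)[OF x(2)] by metric
    moreover have "dist (T (\<rho> x1)) (T (\<rho> x2)) \<le> dist (T' x1) (T' x2) + 2 * C"
      using T'(2)[OF x(1)] T'(2)[OF x(2)] by metric
    moreover have "0 \<le> 2 * C * M" "0 \<le> 2 * C / M" using C M by auto
    ultimately show "1 / M * dist x1 x2 - (D + 2 * C * M + 2 * C + 2 * C / M) \<le> dist (T' x1) (T' x2)"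
      and "dist (T' x1) (T' x2) \<le> M * dist x1 x2 + (D + 2 * C * M + 2 * C + 2 * C / M)"
      using Tb[OF \<rho>(1)[OF x(1)] \<rho>(1)[OF x(2)]] C by (auto simp: algebra_simps)
  next
    fix y assume "y \<in> Y'"
    then obtain y' where y': "y' \<in> Y" "dist y y' \<le> C" using Y by blast
    then obtain x where x: "x \<in> X" "dist y' (T x) \<le> R"
      using T unfolding rough_isometry_def by blast
    then obtain x' where x': "x' \<in> X'" "dist x x' \<le> C" using X by blast
    have "dist x (\<rho> x') \<le> 2 * C" using \<rho>(2)[OF x'(1)] x'(2) by metric
    then have "M * dist x (\<rho> x') \<le> M * (2 * C)" using M by (intro mult_left_mono) auto
    then have "dist (T x) (T (\<rho> x')) \<le> 2 * C * M + D"
      using Tb(2)[OF x(1) \<rho>(1)[OF x'(1)]] by (simp add: algebra_simps)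
    then have "dist y (T' x') \<le> C + R + (2 * C * M + D) + C"
      using y'(2) x(2) T'(2)[OF x'(1)] by metric
    then show "\<exists>x\<in>X'. dist y (T' x) \<le> R + D + 2 * C * M + 2 * C"
      using x'(1) by force
  qed
qed

text \<open>Moving points by a bounded amount before and after \<open>T\<close> carries it over to
  \<open>X'\<close> and \<open>Y'\<close>. Redefining it at the single point \<open>a\<close> is one
  more bounded perturbation, since the constants are free.\<close>

lemma rough_isometric_imp_rooted:
  assumes "rough_isometric X Y" "coarsely_equal X X'" "coarsely_equal Y Y'" "a \<in> X'" "b \<in> Y'"
  shows "rooted_rough_isometric (X', a) (Y', b)"
proof -
  obtain T M D R where T: "M > 0" "D \<ge> 0" "R \<ge> 0" "rough_isometry T X Y M D R"
    using assms(1) unfolding rough_isometric_def by blast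
  obtain C1 where C1: "\<forall>x\<in>X. \<exists>y\<in>X'. dist x y \<le> C1" "\<forall>y\<in>X'. \<exists>x\<in>X. dist y x \<le> C1"
    using assms(2) unfolding coarsely_equal_def by blast
  obtain C2 where C2: "\<forall>x\<in>Y. \<exists>y\<in>Y'. dist x y \<le> C2" "\<forall>y\<in>Y'. \<exists>x\<in>Y. dist y x \<le> C2"
    using assms(3) unfolding coarsely_equal_def by blast
  obtain \<rho> where \<rho>: "\<And>x. x \<in> X' \<Longrightarrow> \<rho> x \<in> X" "\<And>x. x \<in> X' \<Longrightarrow> dist x (\<rho> x) \<le> C1"
    using C1(2) by metis
  obtain \<sigma> where \<sigma>: "\<And>y. y \<in> Y \<Longrightarrow> \<sigma> y \<in> Y'" "\<And>y. y \<in> Y \<Longrightarrow> dist y (\<sigma> y) \<le> C2"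
    using C2(1) by metis
  have TY: "T x \<in> Y" if "x \<in> X" for x
    using T(4) that unfolding rough_isometry_def by auto
  \<comment> \<open>The last term pays for the redefinition at \<open>a\<close>.\<close>
  define C where "C = max (max C1 C2) (dist b (T (\<rho> a)))"
  define T' where "T' = (\<lambda>x. \<sigma> (T (\<rho> x)))(a := b)"
  have C: "C1 \<le> C" "C2 \<le> C" "dist b (T (\<rho> a)) \<le> C" "C \<ge> 0"
    unfolding C_def by (auto simp: le_max_iff_disj)
  have "rough_isometry T' X' Y' M (D + 2 * C * M + 2 * C + 2 * C / M) (R + D + 2 * C * M + 2 * C)"
  proof (rule rough_isometry_perturb[OF T(4) T(1)])
    show "\<rho> x \<in> X" "dist x (\<rho> x) \<le> C" if "x \<in> X'" for x
      using \<rho>[OF that] C by auto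
    show "\<exists>x'\<in>X'. dist x x' \<le> C" if "x \<in> X" for x
      using C1(1) C(1) that by (meson order_trans)
    show "T' \<in> X' \<rightarrow> Y'"
      using \<rho> \<sigma> TY assms(5) unfolding T'_def by auto
    show "dist (T' x) (T (\<rho> x)) \<le> C" if "x \<in> X'" for x
      using \<sigma>(2)[OF TY[OF \<rho>(1)[OF that]]] C unfolding T'_def by (auto simp: dist_commute)
    show "\<exists>y'\<in>Y. dist y y' \<le> C" if "y \<in> Y'" for y
      using C2(2) C(2) that by (meson order_trans)
  qed
  moreover have "D + 2 * C * M + 2 * C + 2 * C / M \<ge> 0" "R + D + 2 * C * M + 2 * C \<ge> 0" "T' a = b"
    using T C by (auto simp: T'_def)
  ultimately show ?thesis
    unfolding rooted_rough_isometric_def using T(1) by blast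
qed

lemma rooted_imp_rough_isometric:
  "rooted_rough_isometric (X, a) (Y, b) \<Longrightarrow> rough_isometric X Y"
  unfolding rooted_rough_isometric_def rough_isometric_def by auto

lemma rough_isometric_coarsely_equal:
  assumes "rough_isometric X Y" "coarsely_equal X X'" "coarsely_equal Y Y'" "X' \<noteq> {}" "Y' \<noteq> {}"
  shows "rough_isometric X' Y'"
  using assms rough_isometric_imp_rooted rooted_imp_rough_isometric by (metis ex_in_conv)

text \<open>Koenig's lemma: values at \<open>x\<close> range over the finite set
  \<open>{..f x}\<close>, so a diagonal choice turns solutions at all finite levels into one
  function. By \<open>local\<close>, the limit inherits \<open>P n\<close> from any solution that
  agrees with it up to \<open>n\<close>.\<close>

lemma koenig_bounded:
  fixes P :: "nat \<Rightarrow> (nat \<Rightarrow> nat) \<Rightarrow> bool" and f :: "nat \<Rightarrow> nat"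
  assumes ex: "\<And>N. \<exists>t. (\<forall>x\<le>N. t x \<le> f x) \<and> P N t"
    and mono: "\<And>N N' t. P N' t \<Longrightarrow> N \<le> N' \<Longrightarrow> P N t"
    and local: "\<And>N t t'. P N t \<Longrightarrow> (\<And>x. x \<le> N \<Longrightarrow> t x = t' x) \<Longrightarrow> P N t'"
  shows "\<exists>t. \<forall>N. P N t"
proof -
  obtain s where s: "\<And>N x. x \<le> N \<Longrightarrow> s N x \<le> f x" "\<And>N. P N (s N)"
    using ex by metis
  \<comment> \<open>Nested infinite index sets: on \<open>I (Suc n)\<close> the value
    \<open>s N n\<close> no longer depends on \<open>N\<close>, and this common value defines the
    limit at \<open>n\<close>.\<close>
  have "\<exists>I. \<forall>n. infinite (I n) \<and> (I (Suc n) \<subseteq> I n \<and> (\<exists>v. \<forall>N\<in>I (Suc n). s N n = v))"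
  proof (rule dependent_nat_choice)
    show "\<exists>I::nat set. infinite I" by auto
    fix I :: "nat set" and n assume "infinite I"
    \<comment> \<open>Discarding \<open>N < n\<close> makes the bound \<open>f n\<close> apply to
      \<open>s N n\<close>, so that the pigeonhole principle has finitely many holes.\<close>
    then have inf: "infinite (I - {..<n})" by auto
    moreover have "(\<lambda>N. s N n) ` (I - {..<n}) \<subseteq> {..f n}"
    proof (rule image_subsetI)
      fix N assume "N \<in> I - {..<n}"
      then show "s N n \<in> {..f n}" using s(1)[of n N] by auto
    qed
    then have "finite ((\<lambda>N. s N n) ` (I - {..<n}))" by (rule finite_subset) auto
    ultimately obtain a where "infinite {N \<in> I - {..<n}. s N n = s a n}"
      using pigeonhole_infinite by blast
    then show "\<exists>J. infinite J \<and> (J \<subseteq> I \<and> (\<exists>v. \<forall>N\<in>J. s N n = v))"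
      by (intro exI[of _ "{N \<in> I - {..<n}. s N n = s a n}"]) auto
  qed
  then obtain I v where I: "\<And>n. infinite (I n)" "\<And>n. I (Suc n) \<subseteq> I n"
    and v: "\<And>n N. N \<in> I (Suc n) \<Longrightarrow> s N n = v n" by metis
  have dec: "I m \<subseteq> I n" if "n \<le> m" for n m
    using that by (induction rule: dec_induct) (use I(2) in auto)
  have "P n v" for n
  proof -
    \<comment> \<open>Nestedness puts this \<open>N\<close> into \<open>I (Suc x)\<close> for all
      \<open>x \<le> n\<close>, so \<open>s N\<close> and \<open>v\<close> agree up to
      \<open>n\<close>.\<close>
    obtain N where N: "N \<in> I (Suc n)" "N \<ge> n"
      using I(1) by (meson infinite_nat_iff_unbounded_le)
    have "P n (s N)" using s(2) mono N(2) by blast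
    then show "P n v"
      by (rule local) (use N(1) dec v in \<open>meson Suc_le_mono in_mono\<close>)
  qed
  then show ?thesis by blast
qed

section \<open>Zero-one law for coin tosses\<close>

abbreviation bool_seq :: "('i \<Rightarrow> bool) measure" where
  "bool_seq \<equiv> Pi\<^sub>M UNIV (\<lambda>_. count_space UNIV)"

definition coins :: "(nat \<Rightarrow> bool) measure" where
  "coins = Pi\<^sub>M UNIV (\<lambda>_. measure_pmf (bernoulli_pmf (1 / 2)))"

lemma sets_coins [measurable_cong]: "sets coins = sets bool_seq"
  unfolding coins_def by (intro sets_PiM_cong) auto

lemma space_coins [simp]: "space coins = UNIV"
  unfolding coins_def by (simp add: space_PiM)

lemma prob_space_coins: "prob_space coins"
  unfolding coins_def by (intro prob_space_PiM measure_pmf.prob_space_axioms)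

text \<open>Independence and fair marginals make the joint law of the indicators over
  \<open>K\<close> a product measure; reading them along the injection \<open>f\<close> merely
  reindexes it. All half-lines thereby receive the same law.\<close>

lemma (in prob_space) distr_indicators_eq_coins:
  assumes indep: "indep_vars (\<lambda>_. count_space UNIV) (\<lambda>i \<omega>. i \<in> X \<omega>) K"
    and half: "\<And>i. i \<in> K \<Longrightarrow> prob {\<omega> \<in> space M. i \<in> X \<omega>} = 1 / 2"
    and f: "inj f" "\<And>n::nat. f n \<in> K"
  shows "distr M bool_seq (\<lambda>\<omega> n. f n \<in> X \<omega>) = coins"
proof -
  let ?B = "measure_pmf (bernoulli_pmf (1 / 2))"
  let ?C = "count_space (UNIV :: bool set)"
  have rv[measurable]: "(\<lambda>\<omega>. i \<in> X \<omega>) \<in> measurable M ?C" if "i \<in> K" for i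
    using indep that unfolding indep_vars_def2 by auto
  have single: "distr M ?C (\<lambda>\<omega>. i \<in> X \<omega>) = ?B" if i: "i \<in> K" for i
  proof -
    note [measurable] = rv[OF i]
    have T: "emeasure M {\<omega> \<in> space M. i \<in> X \<omega>} = ennreal (1 / 2)"
      using half[OF i] by (simp only: emeasure_eq_measure)
    have "prob {\<omega> \<in> space M. i \<notin> X \<omega>} = 1 - prob {\<omega> \<in> space M. i \<in> X \<omega>}"
      by (subst prob_compl[symmetric]) (auto intro!: arg_cong[where f = prob])
    also have "\<dots> = 1 / 2" using half[OF i] by simp
    finally have F: "emeasure M {\<omega> \<in> space M. i \<notin> X \<omega>} = ennreal (1 / 2)"
      by (simp only: emeasure_eq_measure)
    show ?thesis
    proof (rule measure_eqI_countable[where A = UNIV])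
      fix b :: bool
      have "(\<lambda>\<omega>. i \<in> X \<omega>) -` {b} \<inter> space M = {\<omega> \<in> space M. (i \<in> X \<omega>) = b}" by auto
      then show "emeasure (distr M ?C (\<lambda>\<omega>. i \<in> X \<omega>)) {b} = emeasure ?B {b}"
        using T F by (cases b) (auto simp: emeasure_distr emeasure_pmf_single)
    qed auto
  qed
  let ?X = "\<lambda>\<omega>. \<lambda>i\<in>K. i \<in> X \<omega>"
  have "distr M (Pi\<^sub>M K (\<lambda>_. ?C)) ?X = (\<Pi>\<^sub>M i\<in>K. distr M ?C (\<lambda>\<omega>. i \<in> X \<omega>))"
    using indep f(2) rv by (subst indep_vars_iff_distr_eq_PiM'[symmetric]) auto
  also have "\<dots> = (\<Pi>\<^sub>M i\<in>K. ?B)"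
    using single by (intro PiM_cong) auto
  finally have K: "distr M (Pi\<^sub>M K (\<lambda>_. ?C)) ?X = (\<Pi>\<^sub>M i\<in>K. ?B)" .
  have reindex: "(\<lambda>\<omega>. \<lambda>n\<in>UNIV. \<omega> (f n)) \<in> measurable (Pi\<^sub>M K (\<lambda>_. ?C)) bool_seq"
    using f(2) by (intro measurable_restrict measurable_component_singleton)
  have "distr M bool_seq (\<lambda>\<omega> n. f n \<in> X \<omega>) =
      distr (distr M (Pi\<^sub>M K (\<lambda>_. ?C)) ?X) bool_seq (\<lambda>\<omega>. \<lambda>n\<in>UNIV. \<omega> (f n))"
    using f(2)
    by (subst distr_distr[OF reindex]) (auto simp: comp_def restrict_def[of _ UNIV] intro!: measurable_restrict rv)
  also have "\<dots> = distr (\<Pi>\<^sub>M i\<in>K. ?B) (\<Pi>\<^sub>M i\<in>UNIV. ?B) (\<lambda>\<omega>. \<lambda>n\<in>UNIV. \<omega> (f n))"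
    unfolding K by (intro distr_cong sets_PiM_cong) auto
  also have "\<dots> = coins"
    unfolding coins_def using f
    by (intro distr_PiM_reindex[where M = "\<lambda>_. ?B"] measure_pmf.prob_space_axioms) auto
  finally show ?thesis .
qed

text \<open>Kolmogorov's law, once invariance under changing finitely many coins is converted into
  membership in every tail sigma-algebra.\<close>

lemma coins_zero_one:
  assumes G: "G \<in> sets coins"
    and inv: "\<And>a b n. (\<And>i. i \<ge> n \<Longrightarrow> a i = b i) \<Longrightarrow> a \<in> G \<longleftrightarrow> b \<in> G"
  shows "measure coins G = 0 \<or> measure coins G = 1"
proof -
  interpret prob_space coins by (rule prob_space_coins)
  let ?C = "count_space (UNIV :: bool set)"
  define A where "A i = sets (vimage_algebra (space coins) (\<lambda>a. a i) ?C)" for i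
  have A_eq: "A i = {(\<lambda>a. a i) -` B \<inter> space coins | B. B \<in> sets ?C}" for i
    unfolding A_def by (rule sets_vimage_algebra2) auto
  have "distr coins (Pi\<^sub>M UNIV (\<lambda>_. ?C)) (\<lambda>a. \<lambda>i\<in>UNIV. a i) =
      (\<Pi>\<^sub>M i\<in>UNIV. distr coins ?C (\<lambda>a. a i))"
  proof -
    have "distr coins ?C (\<lambda>a. a i) = measure_pmf (bernoulli_pmf (1 / 2))" for i
    proof -
      have "distr coins ?C (\<lambda>a. a i) = distr coins (measure_pmf (bernoulli_pmf (1 / 2))) (\<lambda>a. a i)"
        by (intro distr_cong) auto
      also have "\<dots> = measure_pmf (bernoulli_pmf (1 / 2))"
        unfolding coins_def by (rule distr_PiM_component) (auto intro: measure_pmf.prob_space_axioms)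
      finally show ?thesis .
    qed
    moreover have "distr coins (Pi\<^sub>M UNIV (\<lambda>_. ?C)) (\<lambda>a. \<lambda>i\<in>UNIV. a i) = coins"
      using distr_id2[OF sets_coins[symmetric]] by (simp add: restrict_def)
    ultimately show ?thesis by (simp add: coins_def)
  qed
  then have "indep_vars (\<lambda>_. ?C) (\<lambda>i a. a i) UNIV"
    by (subst indep_vars_iff_distr_eq_PiM') auto
  then have indep: "indep_sets A UNIV"
    unfolding indep_vars_def2 A_eq by auto
  have "G \<in> sigma_sets (space coins) (\<Union> (A ` {n..}))" for n
  proof -
    define N where "N = sigma (space coins) (\<Union> (A ` {n..}))"
    have sub: "\<Union> (A ` {n..}) \<subseteq> Pow (space coins)" by auto
    have sN: "sets N = sigma_sets (space coins) (\<Union> (A ` {n..}))" "space N = space coins"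
      unfolding N_def using sub by (auto simp: sets_measure_of space_measure_of)
    \<comment> \<open>Setting the first \<open>n\<close> coins to \<open>False\<close> is measurable
      for the coordinates from \<open>n\<close> on, and by \<open>inv\<close> the set
      \<open>G\<close> is its own preimage under this map.\<close>
    have "(\<lambda>a i. i \<ge> n \<and> a i) \<in> measurable N bool_seq"
    proof (rule measurable_PiM_single')
      fix i :: nat
      show "(\<lambda>a. i \<ge> n \<and> a i) \<in> measurable N ?C"
      proof (cases "i \<ge> n")
        case True
        have "(\<lambda>a. a i) \<in> measurable N ?C"
        proof (rule measurableI)
          fix B :: "bool set"
          have "(\<lambda>a. a i) -` B \<inter> space coins \<in> A i" unfolding A_eq by auto
          then show "(\<lambda>a. a i) -` B \<inter> space N \<in> sets N"
            unfolding sN using True by (intro sigma_sets.Basic) auto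
        qed auto
        then show ?thesis using True by simp
      qed auto
    qed auto
    then have "(\<lambda>a i. i \<ge> n \<and> a i) -` G \<inter> space N \<in> sets N"
      by (rule measurable_sets) (use G sets_coins in simp)
    also have "(\<lambda>a i. i \<ge> n \<and> a i) -` G \<inter> space N = G"
    proof -
      have "(\<lambda>i. i \<ge> n \<and> a i) \<in> G \<longleftrightarrow> a \<in> G" for a by (rule inv[of n]) auto
      then show ?thesis unfolding sN by auto
    qed
    finally show ?thesis unfolding sN .
  qed
  then have "G \<in> tail_events A" by (auto simp: tail_events_def)
  moreover have "sigma_algebra (space coins) (A i)" for i
    unfolding A_def by (metis sets.sigma_algebra_axioms space_vimage_algebra)
  ultimately show ?thesis using kolmogorov_0_1_law[OF _ indep] by blast
qed

text \<open>The law for one sequence is used twice: for each section of \<open>G\<close>, and then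
  for the set \<open>H\<close> of those \<open>a\<close> whose section has full measure. By Fubini,
  \<open>G\<close> and \<open>H\<close> have the same measure.\<close>

lemma coins_pair_zero_one:
  assumes G: "G \<in> sets (coins \<Otimes>\<^sub>M coins)"
    and inv: "\<And>a a' b b' n. (\<And>i. i \<ge> n \<Longrightarrow> a i = a' i) \<Longrightarrow> (\<And>i. i \<ge> n \<Longrightarrow> b i = b' i) \<Longrightarrow>
      (a, b) \<in> G \<longleftrightarrow> (a', b') \<in> G"
  shows "measure (coins \<Otimes>\<^sub>M coins) G = 0 \<or> measure (coins \<Otimes>\<^sub>M coins) G = 1"
proof -
  interpret prob_space coins by (rule prob_space_coins)
  define H where "H = {a \<in> space coins. emeasure coins (Pair a -` G) = 1}"
  have meas[measurable]: "(\<lambda>a. emeasure coins (Pair a -` G)) \<in> borel_measurable coins"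
    by (rule measurable_emeasure_Pair[OF G])
  have H: "H \<in> sets coins" unfolding H_def by measurable
  have "measure coins (Pair a -` G) = 0 \<or> measure coins (Pair a -` G) = 1" for a
  proof (rule coins_zero_one)
    show "Pair a -` G \<in> sets coins" by (rule sets_Pair1[OF G])
    show "b \<in> Pair a -` G \<longleftrightarrow> b' \<in> Pair a -` G" if "\<And>i. i \<ge> n \<Longrightarrow> b i = b' i" for b b' n
      unfolding vimage_eq by (rule inv[OF refl that])
  qed
  then have eq: "emeasure coins (Pair a -` G) = indicator H a" for a
    by (auto simp: H_def emeasure_eq_measure indicator_def)
  have "a \<in> H \<longleftrightarrow> a' \<in> H" if eq: "\<And>i. i \<ge> n \<Longrightarrow> a i = a' i" for a a' n
  proof -
    have "b \<in> Pair a -` G \<longleftrightarrow> b \<in> Pair a' -` G" for b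
      unfolding vimage_eq by (rule inv[OF eq refl])
    then have "Pair a -` G = Pair a' -` G" by blast
    then show ?thesis unfolding H_def by simp
  qed
  then have "measure coins H = 0 \<or> measure coins H = 1"
    by (rule coins_zero_one[OF H])
  moreover have "emeasure (coins \<Otimes>\<^sub>M coins) G = emeasure coins H"
    using emeasure_pair_measure_alt[OF G] H by (simp add: eq)
  ultimately show ?thesis by (simp add: measure_def)
qed

section \<open>Measurability\<close>

text \<open>Coin number \<open>n\<close> decides about the point \<open>n + 1\<close>.\<close>

definition rooted_nats :: "(nat \<Rightarrow> bool) \<Rightarrow> nat set" where
  "rooted_nats a = {n. n = 0 \<or> a (n - 1)}"

definition rooted_set :: "(nat \<Rightarrow> bool) \<Rightarrow> real set" where
  "rooted_set a = real ` rooted_nats a"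

text \<open>
  Since \<open>t 0 = 0\<close>, the lower estimate forces \<open>x \<le> K * (y + 2 * K)\<close> whenever \<open>t x\<close> is within \<open>K\<close> of \<open>y\<close>,
  so coarse surjectivity at \<open>y\<close> can be decided on \<open>{..N}\<close> for those \<open>y\<close> with \<open>K * (y + 2 * K) \<le> N\<close>.
\<close>

definition partial_rough_isometry ::
    "nat \<Rightarrow> nat set \<Rightarrow> nat set \<Rightarrow> nat \<Rightarrow> (nat \<Rightarrow> nat) \<Rightarrow> bool" where
  "partial_rough_isometry K U V N t \<longleftrightarrow>
     t 0 = 0 \<and> (\<forall>x\<le>N. x \<in> U \<longrightarrow> t x \<in> V) \<and>
     (\<forall>x\<le>N. \<forall>x'\<le>N. x \<in> U \<longrightarrow> x' \<in> U \<longrightarrow>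
        1 / real K * \<bar>real x - real x'\<bar> - real K \<le> \<bar>real (t x) - real (t x')\<bar> \<and>
        \<bar>real (t x) - real (t x')\<bar> \<le> real K * \<bar>real x - real x'\<bar> + real K) \<and>
     (\<forall>y. K * (y + 2 * K) \<le> N \<longrightarrow> y \<in> V \<longrightarrow> (\<exists>x\<le>N. x \<in> U \<and> \<bar>real y - real (t x)\<bar> \<le> real K))"

text \<open>Replaces one infinite map by finite approximations. The root 0 can be imposed freely; it
  bounds the values of \<open>t\<close> pointwise, which is what \<open>koenig_bounded\<close>
  requires.\<close>

lemma rooted_rough_isometric_iff_partial:
  assumes "0 \<in> U" "0 \<in> V"
  shows "rough_isometric (real ` U) (real ` V) \<longleftrightarrow>
    (\<exists>K\<ge>1. \<forall>N. \<exists>t. (\<forall>x\<le>N. t x \<le> K * x + K) \<and> partial_rough_isometry K U V N t)"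
proof
  assume "rough_isometric (real ` U) (real ` V)"
  then have "rooted_rough_isometric (real ` U, 0) (real ` V, 0)"
    by (rule rough_isometric_imp_rooted[OF _ coarsely_equal_refl coarsely_equal_refl])
      (use assms in force)+
  then obtain T M D R where T: "M > 0" "D \<ge> 0" "R \<ge> 0" "T 0 = 0"
    "rough_isometry T (real ` U) (real ` V) M D R"
    unfolding rooted_rough_isometric_def by auto
  obtain K where K: "max (max M D) R \<le> real K" using real_arch_simple by blast
  have K1: "K \<ge> 1" using K T(1) by (cases K) auto
  have T': "rough_isometry T (real ` U) (real ` V) K K K"
    using rough_isometry_mono[OF T(5) T(1)] K by auto
  \<comment> \<open>Outside \<open>U\<close> the value 0 keeps the bound \<open>K * x + K\<close>
    valid for all \<open>x\<close>; on \<open>U\<close> the floor recovers the natural number that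
    is the value of \<open>T\<close>.\<close>
  define t where "t n = (if n \<in> U then nat \<lfloor>T (real n)\<rfloor> else 0)" for n
  have t: "t n \<in> V" "T (real n) = real (t n)" if n: "n \<in> U" for n
  proof -
    obtain m where "m \<in> V" "T (real n) = real m"
      using T' n unfolding rough_isometry_def by blast
    then show "t n \<in> V" "T (real n) = real (t n)" using n by (auto simp: t_def)
  qed
  have t0: "t 0 = 0" using T(4) by (simp add: t_def)
  have bnd: "1 / real K * \<bar>real x - real x'\<bar> - real K \<le> \<bar>real (t x) - real (t x')\<bar>"
      "\<bar>real (t x) - real (t x')\<bar> \<le> real K * \<bar>real x - real x'\<bar> + real K"
    if "x \<in> U" "x' \<in> U" for x x'
    using T' that unfolding rough_isometry_def by (auto simp: dist_real_def simp flip: t(2))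
  have "partial_rough_isometry K U V N t" for N
    unfolding partial_rough_isometry_def
  proof (intro conjI allI impI)
    fix y assume y: "K * (y + 2 * K) \<le> N" "y \<in> V"
    then obtain x where x: "x \<in> U" "\<bar>real y - real (t x)\<bar> \<le> real K"
      using T' t(2) unfolding rough_isometry_def by (force simp: dist_real_def)
    have "1 / real K * real x - real K \<le> real (t x)"
      using bnd(1)[OF x(1) assms(1)] t0 by simp
    then have "1 / real K * real x \<le> real y + 2 * real K" using x(2) by linarith
    then have "real x \<le> real (K * (y + 2 * K))"
      using K1 by (simp add: field_simps)
    then have "x \<le> N" using y(1) by linarith
    then show "\<exists>x\<le>N. x \<in> U \<and> \<bar>real y - real (t x)\<bar> \<le> real K" using x by blast
  qed (use t0 t(1) bnd in auto)
  moreover have "t x \<le> K * x + K" for x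
  proof (cases "x \<in> U")
    case True
    then have "real (t x) \<le> real (K * x + K)" using bnd(2)[OF True assms(1)] t0 by simp
    then show ?thesis by linarith
  qed (auto simp: t_def)
  ultimately show "\<exists>K\<ge>1. \<forall>N. \<exists>t. (\<forall>x\<le>N. t x \<le> K * x + K) \<and> partial_rough_isometry K U V N t"
    using K1 by blast
next
  assume "\<exists>K\<ge>1. \<forall>N. \<exists>t. (\<forall>x\<le>N. t x \<le> K * x + K) \<and> partial_rough_isometry K U V N t"
  then obtain K where K: "K \<ge> 1"
    and ex: "\<And>N. \<exists>t. (\<forall>x\<le>N. t x \<le> K * x + K) \<and> partial_rough_isometry K U V N t" by blast
  have "\<exists>t. \<forall>N. partial_rough_isometry K U V N t"
  proof (rule koenig_bounded[where f = "\<lambda>x. K * x + K"])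
    fix N N' t assume t: "partial_rough_isometry K U V N' t" and N: "N \<le> N'"
    \<comment> \<open>On lowering the level, the preimage found below \<open>N'\<close> must be
      shown to lie below \<open>N\<close>; comparison with the root does this.\<close>
    have "\<exists>x\<le>N. x \<in> U \<and> \<bar>real y - real (t x)\<bar> \<le> real K" if y: "K * (y + 2 * K) \<le> N" "y \<in> V" for y
    proof -
      obtain x where x: "x \<le> N'" "x \<in> U" "\<bar>real y - real (t x)\<bar> \<le> real K"
        using t y N unfolding partial_rough_isometry_def by (meson order_trans)
      have "t 0 = 0" using t unfolding partial_rough_isometry_def by blast
      moreover have "1 / real K * \<bar>real x - real 0\<bar> - real K \<le> \<bar>real (t x) - real (t 0)\<bar>"
        using t x assms(1) unfolding partial_rough_isometry_def by blast
      ultimately have "1 / real K * real x \<le> real y + 2 * real K" using x(3) by simp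
      then have "real x \<le> real (K * (y + 2 * K))"
        using K by (simp add: field_simps)
      then have "x \<le> N" using y(1) by linarith
      then show ?thesis using x by blast
    qed
    then show "partial_rough_isometry K U V N t"
      using t N unfolding partial_rough_isometry_def by (meson order_trans)
  next
    fix N t t' assume t: "partial_rough_isometry K U V N t" and "\<And>x. x \<le> N \<Longrightarrow> t x = t' x"
    then have eq: "\<And>x. x \<le> N \<Longrightarrow> t' x = t x" by simp
    show "partial_rough_isometry K U V N t'"
      using t unfolding partial_rough_isometry_def by (simp add: eq cong: conj_cong)
  qed (rule ex)
  then obtain t where t: "\<And>N. partial_rough_isometry K U V N t" by blast
  have "rough_isometry (\<lambda>x. real (t (nat \<lfloor>x\<rfloor>))) (real ` U) (real ` V) K K K"
    unfolding rough_isometry_def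
  proof (intro conjI ballI funcsetI)
    fix x assume "x \<in> real ` U"
    then obtain n where "n \<in> U" "x = real n" by blast
    then show "real (t (nat \<lfloor>x\<rfloor>)) \<in> real ` V"
      using t[of n] unfolding partial_rough_isometry_def by auto
  next
    fix x1 x2 assume "x1 \<in> real ` U" "x2 \<in> real ` U"
    then obtain n1 n2 where n: "n1 \<in> U" "n2 \<in> U" "x1 = real n1" "x2 = real n2" by blast
    show "1 / real K * dist x1 x2 - real K \<le> dist (real (t (nat \<lfloor>x1\<rfloor>))) (real (t (nat \<lfloor>x2\<rfloor>)))"
      and "dist (real (t (nat \<lfloor>x1\<rfloor>))) (real (t (nat \<lfloor>x2\<rfloor>))) \<le> real K * dist x1 x2 + real K"
      using t[of "max n1 n2"] n unfolding partial_rough_isometry_def dist_real_def by auto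
  next
    fix y assume "y \<in> real ` V"
    then obtain m where "m \<in> V" "y = real m" by blast
    \<comment> \<open>Level \<open>K * (m + 2 * K)\<close> is the first at which a preimage near
      \<open>m\<close> is demanded.\<close>
    then show "\<exists>x\<in>real ` U. dist y (real (t (nat \<lfloor>x\<rfloor>))) \<le> real K"
      using t[of "K * (m + 2 * K)"] unfolding partial_rough_isometry_def dist_real_def by fastforce
  qed
  then show "rough_isometric (real ` U) (real ` V)"
    unfolding rough_isometric_def using K by (intro exI[of _ "real K"] exI) auto
qed

text \<open>The compactness criterion leaves only quantifiers over countable types:
  \<open>K\<close>, \<open>N\<close> and lists.\<close>

lemma sets_rough_isometric_rooted_sets:
  "{p. rough_isometric (rooted_set (fst p)) (rooted_set (snd p))} \<in> sets (coins \<Otimes>\<^sub>M coins)"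
proof -
  \<comment> \<open>Lists replace functions to obtain a countable union.\<close>
  have eq: "(\<exists>t. (\<forall>x\<le>N. t x \<le> K * x + K) \<and> partial_rough_isometry K U V N t) \<longleftrightarrow>
    (\<exists>ts. (\<forall>x\<le>N. (!) ts x \<le> K * x + K) \<and> partial_rough_isometry K U V N ((!) ts))" for K N U V
  proof
    assume "\<exists>t. (\<forall>x\<le>N. t x \<le> K * x + K) \<and> partial_rough_isometry K U V N t"
    then obtain t where t: "\<forall>x\<le>N. t x \<le> K * x + K" "partial_rough_isometry K U V N t" by blast
    \<comment> \<open>The first \<open>N + 1\<close> values suffice, since level \<open>N\<close>
      never looks at arguments beyond \<open>N\<close>.\<close>
    define ts where "ts = map t [0..<Suc N]"
    have ts: "ts ! x = t x" if "x \<le> N" for x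
      unfolding ts_def using that by (subst nth_map) (auto simp del: upt_Suc)
    then have "partial_rough_isometry K U V N ((!) ts)"
      using t(2) unfolding partial_rough_isometry_def by (simp cong: conj_cong)
    then show "\<exists>ts. (\<forall>x\<le>N. (!) ts x \<le> K * x + K) \<and> partial_rough_isometry K U V N ((!) ts)"
      using t(1) ts by (intro exI[of _ ts]) auto
  qed blast
  have [measurable]: "Measurable.pred (coins \<Otimes>\<^sub>M coins) (\<lambda>p. n \<in> rooted_nats (fst p))"
    "Measurable.pred (coins \<Otimes>\<^sub>M coins) (\<lambda>p. n \<in> rooted_nats (snd p))" for n
    unfolding rooted_nats_def mem_Collect_eq by measurable
  have partial[measurable]: "Measurable.pred (coins \<Otimes>\<^sub>M coins)
      (\<lambda>p. partial_rough_isometry K (rooted_nats (fst p)) (rooted_nats (snd p)) N t)" for K N t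
    unfolding partial_rough_isometry_def by measurable
  have iff: "rough_isometric (rooted_set a) (rooted_set b) \<longleftrightarrow>
    (\<exists>K\<ge>1. \<forall>N. \<exists>ts. (\<forall>x\<le>N. ts ! x \<le> K * x + K) \<and>
      partial_rough_isometry K (rooted_nats a) (rooted_nats b) N ((!) ts))" for a b
    unfolding rooted_set_def eq[symmetric]
    by (rule rooted_rough_isometric_iff_partial) (simp_all add: rooted_nats_def)
  have "Measurable.pred (coins \<Otimes>\<^sub>M coins) (\<lambda>p. rough_isometric (rooted_set (fst p)) (rooted_set (snd p)))"
    unfolding iff by measurable
  then show ?thesis by (simp add: pred_def space_pair_measure)
qed

lemma zero_in_rooted_set: "0 \<in> rooted_set a"
  unfolding rooted_set_def rooted_nats_def by force

lemma rooted_set_nonneg: "x \<in> rooted_set a \<Longrightarrow> 0 \<le> x"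
  unfolding rooted_set_def by auto

text \<open>Supplies the tail invariance for the zero-one law: filling in an initial segment makes
  old and new sets equal and is a finite modification of each.\<close>

lemma rough_isometric_rooted_set_cong:
  assumes "\<And>i. i \<ge> n \<Longrightarrow> a i = a' i" "\<And>i. i \<ge> n \<Longrightarrow> b i = b' i"
    and "rough_isometric (rooted_set a) (rooted_set b)"
  shows "rough_isometric (rooted_set a') (rooted_set b')"
proof -
  \<comment> \<open>Coin \<open>i\<close> decides the point \<open>i + 1\<close>, so the coins below
    \<open>n\<close> affect only points up to \<open>n\<close>.\<close>
  define F where "F = real ` {..n}"
  have Un: "rooted_set a \<union> F = rooted_set a' \<union> F" if "\<And>i. i \<ge> n \<Longrightarrow> a i = a' i" for a a'
  proof -
    have "a (m - 1) = a' (m - 1)" if "m > n" for m using that \<open>\<And>i. i \<ge> n \<Longrightarrow> a i = a' i\<close> by simp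
    then show ?thesis
      unfolding rooted_set_def rooted_nats_def F_def image_Un[symmetric]
      by (intro arg_cong[where f = "image real"]) (auto simp: not_le)
  qed
  have fin: "finite F" unfolding F_def by simp
  note ce = coarsely_equal_Un_finite[OF fin zero_in_rooted_set]
  have "rough_isometric (rooted_set a \<union> F) (rooted_set b \<union> F)"
    by (rule rough_isometric_coarsely_equal[OF assms(3) ce ce]) (use zero_in_rooted_set in auto)
  then have "rough_isometric (rooted_set a' \<union> F) (rooted_set b' \<union> F)"
    using Un[of a a'] Un[of b b'] assms by simp
  then show ?thesis
    by (rule rough_isometric_coarsely_equal) (use ce coarsely_equal_sym zero_in_rooted_set in blast)+
qed

section \<open>Gluing half-lines\<close>

lemma rough_isometry_uminus:
  fixes Y :: "'b::real_normed_vector set"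
  assumes "rough_isometry T X Y M D R"
  shows "rough_isometry (\<lambda>x. - T x) X (uminus ` Y) M D R"
  using assms unfolding rough_isometry_def by (auto simp: Pi_iff dist_minus)

lemma rooted_rough_isometric_obtain_nat:
  assumes "rooted_rough_isometric (X, a) (Y, b)"
  obtains T and K :: nat where "K \<ge> 1" "T a = b" "rough_isometry T X Y K K K"
proof -
  obtain T M D R where T: "M > 0" "T a = b" "rough_isometry T X Y M D R"
    using assms unfolding rooted_rough_isometric_def by auto
  obtain K where K: "max (max M D) R \<le> real K" using real_arch_simple by blast
  have "K \<ge> 1" using K T(1) by (cases K) auto
  moreover have "rough_isometry T X Y K K K"
    using rough_isometry_mono[OF T(3) T(1)] K by auto
  ultimately show ?thesis using that T(2) by blast
qed

text \<open>The distance between points on opposite sides of 0 is the sum of their distances to 0,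
  and a rooted map controls each of these. Two errors add up, whence the additive constant
  \<open>2 * K\<close>.\<close>

lemma rough_isometric_glue:
  fixes U1 U2 V1 V2 :: "real set"
  assumes U: "\<And>x. x \<in> U1 \<Longrightarrow> 0 \<le> x" "\<And>x. x \<in> U2 \<Longrightarrow> 0 \<le> x" "0 \<in> U1" "0 \<in> U2"
    and V: "\<And>x. x \<in> V1 \<Longrightarrow> 0 \<le> x" "\<And>x. x \<in> V2 \<Longrightarrow> 0 \<le> x"
    and "rooted_rough_isometric (U1, 0) (V1, 0)" "rooted_rough_isometric (U2, 0) (V2, 0)"
  shows "rough_isometric (U1 \<union> uminus ` U2) (V1 \<union> uminus ` V2)"
proof -
  obtain T1 and K1 :: nat where T1: "K1 \<ge> 1" "T1 0 = 0" "rough_isometry T1 U1 V1 K1 K1 K1"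
    using rooted_rough_isometric_obtain_nat assms(7) by metis
  obtain T2 and K2 :: nat where T2: "K2 \<ge> 1" "T2 0 = 0" "rough_isometry T2 U2 V2 K2 K2 K2"
    using rooted_rough_isometric_obtain_nat assms(8) by metis
  define K where "K = real (K1 + K2)"
  have K: "K \<ge> 1" using T1(1) by (simp add: K_def)
  have T1K: "rough_isometry T1 U1 V1 K K K" and T2K: "rough_isometry T2 U2 V2 K K K"
    using T1(1) T2(1) by (auto simp: K_def intro: rough_isometry_mono[OF T1(3)] rough_isometry_mono[OF T2(3)])
  have b1: "1 / K * \<bar>x - y\<bar> - K \<le> \<bar>T1 x - T1 y\<bar>" "\<bar>T1 x - T1 y\<bar> \<le> K * \<bar>x - y\<bar> + K" "T1 x \<in> V1"
    if "x \<in> U1" "y \<in> U1" for x y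
    using T1K that unfolding rough_isometry_def dist_real_def by auto
  have b2: "1 / K * \<bar>x - y\<bar> - K \<le> \<bar>T2 x - T2 y\<bar>" "\<bar>T2 x - T2 y\<bar> \<le> K * \<bar>x - y\<bar> + K" "T2 x \<in> V2"
    if "x \<in> U2" "y \<in> U2" for x y
    using T2K that unfolding rough_isometry_def dist_real_def by auto
  have c1: "1 / K * x - K \<le> T1 x" "T1 x \<le> K * x + K" if "x \<in> U1" for x
    using b1[OF that U(3)] U(1)[OF that] V(1) T1(2) by auto
  have c2: "1 / K * x - K \<le> T2 x" "T2 x \<le> K * x + K" if "x \<in> U2" for x
    using b2[OF that U(4)] U(2)[OF that] V(2) T2(2) by auto
  \<comment> \<open>Both halves contain 0; \<open>T1\<close> is used there, consistently with
    \<open>T2\<close> because both fix 0.\<close>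
  define T where "T x = (if x \<ge> 0 then T1 x else - T2 (- x))" for x
  have cases: "x \<ge> 0 \<and> x \<in> U1 \<and> T x = T1 x \<or> x < 0 \<and> - x \<in> U2 \<and> T x = - T2 (- x)"
    if "x \<in> U1 \<union> uminus ` U2" for x
    using that U unfolding T_def by force
  have mixed: "1 / K * \<bar>x - y\<bar> - 2 * K \<le> \<bar>T x - T y\<bar> \<and> \<bar>T x - T y\<bar> \<le> K * \<bar>x - y\<bar> + 2 * K"
    if "x \<ge> 0" "x \<in> U1" "T x = T1 x" "y < 0" "- y \<in> U2" "T y = - T2 (- y)" for x y
  proof -
    have "\<bar>x - y\<bar> = x + (- y)" using that by simp
    moreover have "\<bar>T x - T y\<bar> = T1 x + T2 (- y)"
      using that V b1(3) b2(3) by (metis add_nonneg_nonneg abs_of_nonneg diff_minus_eq_add)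
    ultimately show ?thesis
      using c1[OF that(2)] c2[OF that(5)] by (auto simp: algebra_simps add_divide_distrib diff_divide_distrib)
  qed
  have "rough_isometry T (U1 \<union> uminus ` U2) (V1 \<union> uminus ` V2) K (2 * K) K"
    unfolding rough_isometry_def dist_real_def
  proof (intro conjI ballI funcsetI)
    show "T x \<in> V1 \<union> uminus ` V2" if "x \<in> U1 \<union> uminus ` U2" for x
      using cases[OF that] b1(3) b2(3) by auto
  next
    fix x y assume xy: "x \<in> U1 \<union> uminus ` U2" "y \<in> U1 \<union> uminus ` U2"
    have "1 / K * \<bar>x - y\<bar> - 2 * K \<le> \<bar>T x - T y\<bar> \<and> \<bar>T x - T y\<bar> \<le> K * \<bar>x - y\<bar> + 2 * K"
      using cases[OF xy(1)]
    proof (elim disjE conjE)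
      assume x: "0 \<le> x" "x \<in> U1" "T x = T1 x"
      show ?thesis using cases[OF xy(2)]
      proof (elim disjE conjE)
        assume "0 \<le> y" "y \<in> U1" "T y = T1 y"
        then show ?thesis using b1[of x y] x K by auto
      next
        assume "y < 0" "- y \<in> U2" "T y = - T2 (- y)"
        then show ?thesis using mixed x by blast
      qed
    next
      assume x: "x < 0" "- x \<in> U2" "T x = - T2 (- x)"
      show ?thesis using cases[OF xy(2)]
      proof (elim disjE conjE)
        assume "0 \<le> y" "y \<in> U1" "T y = T1 y"
        then show ?thesis using mixed[of y x] x by (simp add: abs_minus_commute)
      next
        assume "y < 0" "- y \<in> U2" "T y = - T2 (- y)"
        then show ?thesis using b2[of "- x" "- y"] x K by (auto simp: abs_minus_commute)
      qed
    qed
    then show "1 / K * \<bar>x - y\<bar> - 2 * K \<le> \<bar>T x - T y\<bar>" "\<bar>T x - T y\<bar> \<le> K * \<bar>x - y\<bar> + 2 * K" by auto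
  next
    fix y assume "y \<in> V1 \<union> uminus ` V2"
    then show "\<exists>x\<in>U1 \<union> uminus ` U2. \<bar>y - T x\<bar> \<le> K"
    proof
      assume "y \<in> V1"
      then obtain x where "x \<in> U1" "\<bar>y - T1 x\<bar> \<le> K"
        using T1K unfolding rough_isometry_def dist_real_def by blast
      then show ?thesis using U(1) by (intro bexI[of _ x]) (auto simp: T_def)
    next
      assume "y \<in> uminus ` V2"
      then obtain x where "x \<in> U2" "\<bar>- y - T2 x\<bar> \<le> K"
        using T2K unfolding rough_isometry_def dist_real_def by force
      then show ?thesis using U(2)[of x] T1(2) T2(2)
        by (intro bexI[of _ "- x"]) (cases "x = 0"; auto simp: T_def)+
    qed
  qed
  moreover have "K > 0" "2 * K \<ge> 0" using K by auto
  ultimately show ?thesis unfolding rough_isometric_def by (meson less_imp_le)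
qed

section \<open>Ends\<close>

text \<open>The block \<open>{k * m..<k * m + m}\<close> has relative length about \<open>1 / k\<close>, so this makes gaps \<open>o(n)\<close>.\<close>

definition small_gaps :: "(nat \<Rightarrow> bool) \<Rightarrow> bool" where
  "small_gaps a \<longleftrightarrow> (\<forall>k. \<exists>m0. \<forall>m\<ge>m0. \<exists>i\<in>{k * m..<k * m + m}. a i)"

text \<open>The first block \<open>{k * m..<k * m + m}\<close> starting beyond \<open>n\<close> has
  \<open>m = n div k + 1\<close>; it starts no later than \<open>n + k\<close> and has length
  \<open>n div k + 1\<close>.\<close>

lemma small_gaps_next:
  assumes "small_gaps a" "k \<ge> 1"
  obtains N where "\<And>n. n \<ge> N \<Longrightarrow> \<exists>u\<in>rooted_nats a. n < u \<and> u \<le> n + n div k + k + 1"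
proof -
  obtain m0 where m0: "\<And>m. m \<ge> m0 \<Longrightarrow> \<exists>i\<in>{k * m..<k * m + m}. a i"
    using assms(1) unfolding small_gaps_def by blast
  have "\<exists>u\<in>rooted_nats a. n < u \<and> u \<le> n + n div k + k + 1" if n: "n \<ge> k * m0" for n
  proof -
    define m where "m = n div k + 1"
    have "n div k \<ge> m0" using n assms(2) by (simp add: less_eq_div_iff_mult_less_eq mult.commute)
    then obtain i where i: "k * m \<le> i" "i < k * m + m" "a i" using m0[of m] by (auto simp: m_def)
    have "k * m = n - n mod k + k" unfolding m_def by (simp add: algebra_simps minus_mod_eq_mult_div)
    moreover have "n mod k < k" "n mod k \<le> n" using assms(2) by auto
    \<comment> \<open>Coin \<open>i\<close> yields the point \<open>Suc i\<close>; the strict upper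
      bound on \<open>i\<close> absorbs the shift.\<close>
    ultimately have "n < Suc i" "Suc i \<le> n + n div k + k + 1" using i by (auto simp: m_def)
    then show ?thesis using i(3) by (intro bexI[of _ "Suc i"]) (auto simp: rooted_nats_def)
  qed
  then show ?thesis using that by blast
qed

text \<open>Meant for a rough isometry on one half-line. The lower estimate pushes
  \<open>t x\<close> away from 0 linearly in \<open>x\<close>, while small gaps keep consecutive
  values too close together to jump across 0.\<close>

lemma eventually_constant_sign:
  fixes t :: "nat \<Rightarrow> real" and K :: nat
  assumes gaps: "small_gaps a" and K: "K \<ge> 1"
    and lower: "\<And>x. x \<in> rooted_nats a \<Longrightarrow> 1 / K * x - K \<le> \<bar>t x\<bar>"
    and upper: "\<And>x y. x \<in> rooted_nats a \<Longrightarrow> y \<in> rooted_nats a \<Longrightarrow> \<bar>t x - t y\<bar> \<le> K * \<bar>real x - real y\<bar> + K"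
  obtains N where "(\<forall>x\<in>rooted_nats a. x \<ge> N \<longrightarrow> t x > 0) \<or> (\<forall>x\<in>rooted_nats a. x \<ge> N \<longrightarrow> t x < 0)"
proof -
  define k where "k = K * K"
  have k: "k \<ge> 1" using K by (simp add: k_def)
  obtain N0 where N0: "\<And>n. n \<ge> N0 \<Longrightarrow> \<exists>u\<in>rooted_nats a. n < u \<and> u \<le> n + n div k + k + 1"
    using small_gaps_next[OF gaps k] by blast
  \<comment> \<open>The second term makes \<open>x / K\<close> exceed
    \<open>3 * K + K * (k + 1)\<close>, which is what contradicts
    \<open>2 * (x / K - K) \<le> x / K + K * (k + 1) + K\<close>.\<close>
  define N where "N = max N0 (K * (3 * K + K * (k + 1)) + 1)"
  have large: "1 / K * x > 3 * K + K * (k + 1)" if "x \<ge> N" for x :: nat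
  proof -
    have "K * (3 * K + K * (k + 1)) < x" using that by (simp add: N_def)
    then have "real (K * (3 * K + K * (k + 1))) < real x" by (simp only: of_nat_less_iff)
    then show ?thesis using K by (simp add: field_simps)
  qed
  \<comment> \<open>A sign change from \<open>x\<close> to \<open>y\<close> needs a jump of at least \<open>2 * (x / K - K)\<close>, whereas the choice
    \<open>k = K\<^sup>2\<close> bounds jumps by \<open>x / K\<close> plus a constant.\<close>
  have same_sign: "t x > 0 \<longleftrightarrow> t y > 0"
    if x: "x \<in> rooted_nats a" "x \<ge> N" and y: "y \<in> rooted_nats a" "x < y" "y \<le> x + x div k + k + 1" for x y
  proof -
    have "real (y - x) \<le> real (x div k) + k + 1" using y by linarith
    also have "real (x div k) \<le> x / k" by (rule of_nat_div_le_of_nat)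
    finally have "\<bar>real x - real y\<bar> \<le> x / k + k + 1" using y(2) by linarith
    then have "K * \<bar>real x - real y\<bar> \<le> K * (x / k + k + 1)" by (intro mult_left_mono) auto
    also have "\<dots> = 1 / K * x + K * (k + 1)"
      using K by (simp add: k_def field_simps)
    finally have "\<bar>t x - t y\<bar> \<le> 1 / K * x + K * (k + 1) + K" using upper[OF x(1) y(1)] by linarith
    moreover have "1 / K * x \<le> 1 / K * y" using y(2) by (intro mult_left_mono) auto
    ultimately show ?thesis using lower[OF x(1)] lower[OF y(1)] large[OF x(2)] by linarith
  qed
  obtain p where p: "p \<in> rooted_nats a" "p > N" using N0[of N] by (auto simp: N_def)
  have "\<forall>x\<in>rooted_nats a. p \<le> x \<and> x \<le> n \<longrightarrow> (t x > 0 \<longleftrightarrow> t p > 0)" if "n \<ge> p" for n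
    using that
  proof (induction n rule: dec_induct)
    case (step n)
    show ?case
    proof (intro ballI impI)
      fix y assume y: "y \<in> rooted_nats a" "p \<le> y \<and> y \<le> Suc n"
      show "t y > 0 \<longleftrightarrow> t p > 0"
      proof (cases "y = Suc n")
        case True
        \<comment> \<open>The maximum of \<open>A\<close> is the last point before
          \<open>Suc n\<close>. The point \<open>u\<close> that follows it within the gap bound
          cannot lie in \<open>A\<close>, so \<open>Suc n \<le> u\<close> and the gap bound holds
          for \<open>Suc n\<close> too.\<close>
        define A where "A = {x \<in> rooted_nats a. p \<le> x \<and> x \<le> n}"
        have A: "finite A" "p \<in> A" using p step.hyps unfolding A_def by auto
        then have max: "Max A \<in> A" by (metis Max_in empty_iff)
        then have mx: "Max A \<in> rooted_nats a" "p \<le> Max A" "Max A \<le> n" unfolding A_def by auto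
        then obtain u where u: "u \<in> rooted_nats a" "Max A < u" "u \<le> Max A + Max A div k + k + 1"
          using N0[of "Max A"] p(2) by (auto simp: N_def)
        have "u \<notin> A" using u(2) A(1) by (meson Max_ge leD)
        then have "y \<le> u" using True u mx unfolding A_def by auto
        then have "t (Max A) > 0 \<longleftrightarrow> t y > 0"
          using u(3) y mx p(2) True by (intro same_sign) auto
        then show ?thesis using step.IH mx by blast
      qed (use step.IH y in auto)
    qed
  qed (use p in auto)
  then have const: "t x > 0 \<longleftrightarrow> t p > 0" if "x \<in> rooted_nats a" "x \<ge> p" for x
    using that by blast
  \<comment> \<open>Beyond the threshold the lower estimate also excludes 0, so a constant sign that
    is not positive is negative.\<close>
  have "t x \<noteq> 0" if "x \<in> rooted_nats a" "x \<ge> p" for x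
  proof -
    have "0 \<le> real K * real (k + 1)" by simp
    then show ?thesis using lower[OF that(1)] large[of x] that(2) p(2) by linarith
  qed
  then show ?thesis using const that[of p] by (metis linorder_neqE_linordered_idom)
qed

text \<open>If the left half of \<open>X\<close> also went to the positive side, far negative points
  of the target would have nothing near them in the image. So it goes to the negative side, and only
  the right half reaches far points of \<open>rooted_set b1\<close>.\<close>

lemma rough_isometric_positive_end:
  fixes a1 a2 b1 b2 :: "nat \<Rightarrow> bool" and T :: "real \<Rightarrow> real" and K :: nat
  defines "X \<equiv> rooted_set a1 \<union> uminus ` rooted_set a2"
  assumes gaps: "small_gaps a2" "small_gaps b2"
    and K: "K \<ge> 1" and T0: "T 0 = 0"
    and T: "rough_isometry T X (rooted_set b1 \<union> uminus ` rooted_set b2) K K K"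
    and pos: "\<And>x. x \<in> rooted_nats a1 \<Longrightarrow> x \<ge> N1 \<Longrightarrow> T (real x) > 0"
  shows "rough_isometric (rooted_set a1) (rooted_set b1)"
proof -
  have mem1: "real n \<in> X" if "n \<in> rooted_nats a1" for n
    using that by (auto simp: X_def rooted_set_def)
  have mem2: "- real n \<in> X" if "n \<in> rooted_nats a2" for n
    using that by (auto simp: X_def rooted_set_def)
  have X0: "0 \<in> X" using zero_in_rooted_set by (auto simp: X_def)
  have T_bd: "1 / K * \<bar>x - y\<bar> - K \<le> \<bar>T x - T y\<bar>" "\<bar>T x - T y\<bar> \<le> K * \<bar>x - y\<bar> + K"
    "T x \<in> rooted_set b1 \<union> uminus ` rooted_set b2"
    if "x \<in> X" "y \<in> X" for x y :: real
    using T that unfolding rough_isometry_def dist_real_def by auto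
  have T_surj: "\<exists>x\<in>X. \<bar>y - T x\<bar> \<le> K" if "y \<in> rooted_set b1 \<union> uminus ` rooted_set b2" for y
    using T that unfolding rough_isometry_def dist_real_def by auto
  have T_abs: "\<bar>T x\<bar> \<le> K * real n + K" if "x \<in> X" "\<bar>x\<bar> \<le> real n" for x n
  proof -
    have "K * \<bar>x\<bar> \<le> K * real n" using that(2) by (intro mult_left_mono) auto
    then show ?thesis using T_bd(2)[OF that(1) X0] T0 by simp
  qed
  obtain N2 where N2: "(\<forall>x\<in>rooted_nats a2. x \<ge> N2 \<longrightarrow> T (- real x) > 0) \<or>
      (\<forall>x\<in>rooted_nats a2. x \<ge> N2 \<longrightarrow> T (- real x) < 0)"
  proof (rule eventually_constant_sign[OF gaps(1) K, of "\<lambda>x. T (- real x)"])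
    show "1 / K * real x - K \<le> \<bar>T (- real x)\<bar>" if "x \<in> rooted_nats a2" for x
      using T_bd(1)[OF mem2[OF that] X0] T0 by simp
    show "\<bar>T (- real x) - T (- real y)\<bar> \<le> K * \<bar>real x - real y\<bar> + K"
      if "x \<in> rooted_nats a2" "y \<in> rooted_nats a2" for x y
      using T_bd(2)[OF mem2[OF that(1)] mem2[OF that(2)]] by (simp add: abs_minus_commute)
  qed
  have "\<not> (\<forall>x\<in>rooted_nats a2. x \<ge> N2 \<longrightarrow> T (- real x) > 0)"
  proof
    assume neg: "\<forall>x\<in>rooted_nats a2. x \<ge> N2 \<longrightarrow> T (- real x) > 0"
    obtain N where N: "\<And>n. n \<ge> N \<Longrightarrow> \<exists>u\<in>rooted_nats b2. n < u \<and> u \<le> n + n div 1 + 1 + 1"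
      using small_gaps_next[OF gaps(2), of 1] by auto
    \<comment> \<open>Points within \<open>N1 + N2\<close> of 0 have images of size at most
      \<open>K * (N1 + N2) + K\<close>; \<open>v\<close> exceeds this by more than the tolerance
      \<open>K\<close>.\<close>
    then obtain v where v: "v \<in> rooted_nats b2" "v > max N (K * (N1 + N2) + 2 * K)"
      by (meson max.cobounded1)
    have "- real v \<in> uminus ` rooted_set b2" using v(1) by (auto simp: rooted_set_def)
    then obtain x where x: "x \<in> X" "\<bar>- real v - T x\<bar> \<le> K" using T_surj by blast
    have vK: "real v > real (K * (N1 + N2) + 2 * K)" using v(2) by (simp only: of_nat_less_iff)
    then have "T x < 0" using x(2) by (simp, linarith)
    then have "\<bar>x\<bar> \<le> real (N1 + N2)"
      using x(1) pos neg by (force simp: X_def rooted_set_def not_le)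
    then have "\<bar>T x\<bar> \<le> K * real (N1 + N2) + K" by (rule T_abs[OF x(1)])
    then show False using x(2) vK by simp
  qed
  then have neg: "T (- real x) < 0" if "x \<in> rooted_nats a2" "x \<ge> N2" for x
    using N2 that by blast
  \<comment> \<open>The finitely many points before \<open>N1\<close> may land on the negative side;
    adding their images to the target is a bounded change.\<close>
  define F where "F = T ` real ` {x \<in> rooted_nats a1. x < N1}"
  have "rough_isometry T (rooted_set a1) (rooted_set b1 \<union> F) K K (K * N2 + 2 * K)"
    unfolding rough_isometry_def dist_real_def
  proof (intro conjI ballI funcsetI)
    fix x assume "x \<in> rooted_set a1"
    then obtain n where n: "n \<in> rooted_nats a1" "x = real n" by (auto simp: rooted_set_def)
    show "T x \<in> rooted_set b1 \<union> F"
    proof (cases "n < N1")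
      case False
      then have "T x > 0" using pos n by auto
      then show ?thesis using T_bd(3)[OF mem1[OF n(1)] X0] n(2) rooted_set_nonneg by fastforce
    qed (use n in \<open>auto simp: F_def\<close>)
  next
    fix x y assume "x \<in> rooted_set a1" "y \<in> rooted_set a1"
    then show "1 / K * \<bar>x - y\<bar> - K \<le> \<bar>T x - T y\<bar>" "\<bar>T x - T y\<bar> \<le> K * \<bar>x - y\<bar> + K"
      using T_bd by (auto simp: X_def)
  next
    fix y assume "y \<in> rooted_set b1 \<union> F"
    then show "\<exists>x\<in>rooted_set a1. \<bar>y - T x\<bar> \<le> real (K * N2 + 2 * K)"
    proof
      assume y: "y \<in> rooted_set b1"
      then obtain x where x: "x \<in> X" "\<bar>y - T x\<bar> \<le> K" using T_surj by blast
      show ?thesis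
      proof (cases "x \<in> rooted_set a1")
        case True
        have "real K \<le> real (K * N2 + 2 * K)" by simp
        then show ?thesis using True x(2) by (meson order_trans)
      next
        case False
        then obtain n where n: "n \<in> rooted_nats a2" "x = - real n"
          using x(1) by (auto simp: X_def rooted_set_def)
        \<comment> \<open>The left half never maps above this bound, so a \<open>y\<close>
          approximated from there is at most \<open>K * N2 + 2 * K\<close>, and the root with
          \<open>T 0 = 0\<close> can approximate it instead.\<close>
        have "T x \<le> K * N2 + K"
        proof (cases "n \<ge> N2")
          case True
          have "(0 :: real) \<le> K * N2 + K" by simp
          moreover have "T x < 0" using neg[OF n(1) True] n(2) by simp
          ultimately show ?thesis by linarith
        next
          case False
          then have "\<bar>x\<bar> \<le> real N2" using n(2) by simp
          then show ?thesis using T_abs[OF x(1)] by fastforce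
        qed
        then have "\<bar>y - T 0\<bar> \<le> real (K * N2 + 2 * K)"
          using x(2) rooted_set_nonneg[OF y] T0 by simp
        then show ?thesis using zero_in_rooted_set by blast
      qed
    next
      assume "y \<in> F"
      then obtain x where "x \<in> rooted_set a1" "y = T x" by (auto simp: F_def rooted_set_def)
      then show ?thesis by (intro bexI[of _ x]) auto
    qed
  qed
  moreover have "real K > 0" "real (K * N2 + 2 * K) \<ge> 0" using K by auto
  ultimately have "rough_isometric (rooted_set a1) (rooted_set b1 \<union> F)"
    unfolding rough_isometric_def by (meson less_imp_le)
  moreover have "coarsely_equal (rooted_set b1 \<union> F) (rooted_set b1)"
    by (rule coarsely_equal_sym[OF coarsely_equal_Un_finite[OF _ zero_in_rooted_set]]) (simp add: F_def)
  ultimately show ?thesis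
    by (rule rough_isometric_coarsely_equal[OF _ coarsely_equal_refl]) (use zero_in_rooted_set in auto)
qed

text \<open>The right end of the source goes to a single end of the target. If that is the negative
  one, reflecting the target exchanges \<open>b1\<close> and \<open>b2\<close>.\<close>

lemma rough_isometric_ends:
  assumes gaps: "small_gaps a1" "small_gaps a2" "small_gaps b1" "small_gaps b2"
    and "rough_isometric (rooted_set a1 \<union> uminus ` rooted_set a2) (rooted_set b1 \<union> uminus ` rooted_set b2)"
      (is "rough_isometric ?X ?Y")
  shows "rough_isometric (rooted_set a1) (rooted_set b1) \<or> rough_isometric (rooted_set a1) (rooted_set b2)"
proof -
  have "rooted_rough_isometric (?X, 0) (?Y, 0)"
    by (rule rough_isometric_imp_rooted[OF assms(5) coarsely_equal_refl coarsely_equal_refl])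
      (use zero_in_rooted_set in auto)
  then obtain T and K :: nat where K: "K \<ge> 1" "T 0 = 0" and T: "rough_isometry T ?X ?Y K K K"
    using rooted_rough_isometric_obtain_nat by metis
  have mem1: "real n \<in> ?X" if "n \<in> rooted_nats a1" for n
    using that by (auto simp: rooted_set_def)
  have X0: "0 \<in> ?X" using zero_in_rooted_set by auto
  have T_bd: "1 / K * \<bar>x - y\<bar> - K \<le> \<bar>T x - T y\<bar>" "\<bar>T x - T y\<bar> \<le> K * \<bar>x - y\<bar> + K"
    if "x \<in> ?X" "y \<in> ?X" for x y :: real
    using T that unfolding rough_isometry_def dist_real_def by auto
  obtain N where "(\<forall>x\<in>rooted_nats a1. x \<ge> N \<longrightarrow> T (real x) > 0) \<or>
      (\<forall>x\<in>rooted_nats a1. x \<ge> N \<longrightarrow> T (real x) < 0)"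
  proof (rule eventually_constant_sign[OF gaps(1) K(1), of "\<lambda>x. T (real x)"])
    show "1 / K * real x - K \<le> \<bar>T (real x)\<bar>" if "x \<in> rooted_nats a1" for x
      using T_bd(1)[OF mem1[OF that] X0] K(2) by simp
    show "\<bar>T (real x) - T (real y)\<bar> \<le> K * \<bar>real x - real y\<bar> + K"
      if "x \<in> rooted_nats a1" "y \<in> rooted_nats a1" for x y
      using T_bd(2)[OF mem1[OF that(1)] mem1[OF that(2)]] .
  qed
  then show ?thesis
  proof
    assume "\<forall>x\<in>rooted_nats a1. x \<ge> N \<longrightarrow> T (real x) > 0"
    then show ?thesis using rough_isometric_positive_end[OF gaps(2,4) K T] by blast
  next
    assume neg: "\<forall>x\<in>rooted_nats a1. x \<ge> N \<longrightarrow> T (real x) < 0"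
    have "uminus ` ?Y = rooted_set b2 \<union> uminus ` rooted_set b1"
      by (auto simp: image_Un image_image)
    then have "rough_isometry (\<lambda>x. - T x) ?X (rooted_set b2 \<union> uminus ` rooted_set b1) K K K"
      using rough_isometry_uminus[OF T] by simp
    then show ?thesis
      using rough_isometric_positive_end[OF gaps(2,3) K(1), of "\<lambda>x. - T x"] neg K(2) by auto
  qed
qed

section \<open>The two percolation models\<close>

lemma measure_coins_all_False:
  assumes "finite J"
  shows "{a \<in> space coins. \<forall>i\<in>J. \<not> a i} \<in> sets coins"
    and "measure coins {a \<in> space coins. \<forall>i\<in>J. \<not> a i} = (1 / 2) ^ card J"
proof -
  interpret product_prob_space "\<lambda>_. measure_pmf (bernoulli_pmf (1 / 2))" "UNIV :: nat set"
    by (intro product_prob_spaceI measure_pmf.prob_space_axioms)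
  have "emeasure coins {a \<in> space coins. \<forall>i\<in>J. a i \<in> {False}} = (\<Prod>i\<in>J. emeasure (measure_pmf (bernoulli_pmf (1 / 2))) {False})"
    unfolding coins_def by (rule emeasure_PiM_Collect) (use assms in auto)
  also have "\<dots> = ennreal ((1 / 2) ^ card J)"
    by (simp add: emeasure_pmf_single ennreal_power del: ennreal_half)
  finally show "measure coins {a \<in> space coins. \<forall>i\<in>J. \<not> a i} = (1 / 2) ^ card J"
    by (simp add: measure_def)
  show "{a \<in> space coins. \<forall>i\<in>J. \<not> a i} \<in> sets coins"
    using assms by measurable
qed

text \<open>Borel-Cantelli for each \<open>k\<close>: the block for \<open>m\<close> is empty with
  probability \<open>(1 / 2) ^ m\<close>, which is summable, and there are countably many
  \<open>k\<close>.\<close>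

lemma AE_small_gaps: "AE a in coins. small_gaps a"
proof -
  interpret prob_space coins by (rule prob_space_coins)
  have "AE a in coins. \<exists>m0. \<forall>m\<ge>m0. \<exists>i\<in>{k * m..<k * m + m}. a i" for k
  proof -
    define E where "E m = {a \<in> space coins. \<forall>i\<in>{k * m..<k * m + m}. \<not> a i}" for m
    have "AE a in coins. \<forall>\<^sub>F m in sequentially. a \<in> space coins - E m"
    proof (rule borel_cantelli_AE1)
      show "E m \<in> sets coins" for m
        unfolding E_def by (intro measure_coins_all_False) auto
      show "emeasure coins (E m) < \<infinity>" for m
        by (simp add: emeasure_eq_measure)
      have "measure coins (E m) = (1 / 2) ^ m" for m
        unfolding E_def by (subst measure_coins_all_False) auto
      then show "summable (\<lambda>m. measure coins (E m))"
        by (simp add: summable_geometric)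
    qed
    then show ?thesis
      by eventually_elim (auto simp: E_def eventually_sequentially)
  qed
  then show ?thesis unfolding small_gaps_def by (simp add: AE_all_countable)
qed

lemma (in prob_space) AE_small_gaps_indicators:
  assumes indep: "indep_vars (\<lambda>_. count_space UNIV) (\<lambda>i \<omega>. i \<in> X \<omega>) K"
    and half: "\<And>i. i \<in> K \<Longrightarrow> prob {\<omega> \<in> space M. i \<in> X \<omega>} = 1 / 2"
    and f: "inj f" "\<And>n::nat. f n \<in> K"
  shows "AE \<omega> in M. small_gaps (\<lambda>n. f n \<in> X \<omega>)"
proof -
  have "(\<lambda>\<omega> n. f n \<in> X \<omega>) \<in> measurable M bool_seq"
    using indep f(2) unfolding indep_vars_def2 by (intro measurable_PiM_single') auto
  then show ?thesis
    by (rule AE_distrD) (simp only: distr_indicators_eq_coins[OF assms] AE_small_gaps)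
qed

text \<open>\<open>f\<close> and \<open>g\<close> may run along different half-lines, so this covers
  all pairings of ends as well as the rooted model. Independence within each set gives the two
  factors, independence of \<open>X\<close> and \<open>Y\<close> their product.\<close>

lemma (in prob_space) distr_independent_indicators_eq_coins:
  assumes X: "indep_vars (\<lambda>_. count_space UNIV) (\<lambda>i \<omega>. i \<in> X \<omega>) I"
      "\<And>i. i \<in> I \<Longrightarrow> prob {\<omega> \<in> space M. i \<in> X \<omega>} = 1 / 2"
    and Y: "indep_vars (\<lambda>_. count_space UNIV) (\<lambda>i \<omega>. i \<in> Y \<omega>) J"
      "\<And>i. i \<in> J \<Longrightarrow> prob {\<omega> \<in> space M. i \<in> Y \<omega>} = 1 / 2"
    and indep: "independent_random_sets M X Y"
    and f: "inj f" "\<And>n::nat. f n \<in> I" and g: "inj g" "\<And>n::nat. g n \<in> J"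
  defines "Z \<equiv> \<lambda>\<omega>. (\<lambda>n. f n \<in> X \<omega>, \<lambda>n. g n \<in> Y \<omega>)"
  shows "Z \<in> measurable M (coins \<Otimes>\<^sub>M coins)" "distr M (coins \<Otimes>\<^sub>M coins) Z = coins \<Otimes>\<^sub>M coins"
proof -
  have re: "(\<lambda>h n. h (e n)) \<in> measurable bool_seq bool_seq" for e :: "nat \<Rightarrow> 'b"
    by (rule measurable_PiM_single') auto
  have "indep_var bool_seq ((\<lambda>h n. h (f n)) \<circ> (\<lambda>\<omega> i. i \<in> X \<omega>)) bool_seq ((\<lambda>h n. h (g n)) \<circ> (\<lambda>\<omega> i. i \<in> Y \<omega>))"
    by (rule indep_var_compose[OF _ re re]) (use indep in \<open>simp add: independent_random_sets_def\<close>)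
  then have Z: "(\<lambda>\<omega> n. f n \<in> X \<omega>) \<in> measurable M bool_seq" "(\<lambda>\<omega> n. g n \<in> Y \<omega>) \<in> measurable M bool_seq"
      "distr M bool_seq (\<lambda>\<omega> n. f n \<in> X \<omega>) \<Otimes>\<^sub>M distr M bool_seq (\<lambda>\<omega> n. g n \<in> Y \<omega>) =
        distr M (bool_seq \<Otimes>\<^sub>M bool_seq) Z"
    by (auto simp: indep_var_distribution_eq comp_def Z_def)
  have sets: "sets (coins \<Otimes>\<^sub>M coins) = sets (bool_seq \<Otimes>\<^sub>M bool_seq)"
    by (intro sets_pair_measure_cong sets_coins)
  show "Z \<in> measurable M (coins \<Otimes>\<^sub>M coins)"
    unfolding measurable_cong_sets[OF refl sets] Z_def using Z by measurable
  have "distr M (coins \<Otimes>\<^sub>M coins) Z = distr M (bool_seq \<Otimes>\<^sub>M bool_seq) Z"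
    by (intro distr_cong sets) auto
  then show "distr M (coins \<Otimes>\<^sub>M coins) Z = coins \<Otimes>\<^sub>M coins"
    using Z(3) distr_indicators_eq_coins[OF X f] distr_indicators_eq_coins[OF Y g] by simp
qed

text \<open>Whether or not 0 was deleted, it is added so that both half-lines are rooted there.
  \<open>Suc n\<close> matches the convention that coin \<open>n\<close> decides the point
  \<open>n + 1\<close>.\<close>

lemma insert_zero_int_eq_rooted_sets:
  "real_of_int ` X \<union> {0} =
    rooted_set (\<lambda>n. int (Suc n) \<in> X) \<union> uminus ` rooted_set (\<lambda>n. - int (Suc n) \<in> X)"
    (is "?L = ?R")
proof -
  have nats: "rooted_nats a = insert 0 (Suc ` Collect a)" for a
    unfolding rooted_nats_def by (auto simp: image_iff) (metis Suc_pred neq0_conv)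
  have "real_of_int x \<in> ?R" if "x \<in> X" for x
  proof -
    consider "x = 0" | n where "x = int (Suc n)" | n where "x = - int (Suc n)"
      by (metis int_cases3 not0_implies_Suc of_nat_0_less_iff neq0_conv)
    then show ?thesis
    proof cases
      case (2 n)
      then show ?thesis using that by (auto simp: rooted_set_def nats image_iff intro!: bexI[of _ "Suc n"])
    next
      case (3 n)
      then have "real (Suc n) \<in> rooted_set (\<lambda>n. - int (Suc n) \<in> X)"
        using that unfolding rooted_set_def nats by blast
      then show ?thesis using 3 by force
    qed (simp add: zero_in_rooted_set)
  qed
  moreover have "?R \<subseteq> ?L"
  proof -
    have "real (Suc n) \<in> real_of_int ` X" if "int (Suc n) \<in> X" for n
      using that by (metis image_eqI of_int_of_nat_eq)
    moreover have "- real (Suc n) \<in> real_of_int ` X" if "- int (Suc n) \<in> X" for n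
      using that by (metis image_eqI of_int_minus of_int_of_nat_eq)
    ultimately show ?thesis unfolding rooted_set_def nats by auto
  qed
  ultimately show ?thesis using zero_in_rooted_set by auto
qed

theorem theorem2p3:
  fixes P :: "'v measure" and X Y :: "'v \<Rightarrow> int set"
    and Q :: "'w measure" and A B :: "'w \<Rightarrow> nat set"
  assumes "prob_space P"
    and "bernoulli_percolation_Z P X" and "bernoulli_percolation_Z P Y"
    and "independent_random_sets P X Y"
    and "prob_space Q"
    and "rooted_bernoulli_percolation_N Q A" and "rooted_bernoulli_percolation_N Q B"
    and "independent_random_sets Q A B"
  shows "(AE \<omega> in P. rough_isometric (real_of_int ` X \<omega>) (real_of_int ` Y \<omega>)) \<longleftrightarrow>
         measure Q {\<omega> \<in> space Q. rooted_rough_isometric (real ` A \<omega>, 0) (real ` B \<omega>, 0)} > 0"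
proof -
  interpret P: prob_space P by fact
  interpret Q: prob_space Q by fact
  define \<mu> where "\<mu> = coins \<Otimes>\<^sub>M coins"
  \<comment> \<open>Roots come for free, so this one event on pairs of coin sequences serves both
    statements.\<close>
  define G where "G = {p. rough_isometric (rooted_set (fst p)) (rooted_set (snd p))}"
  have G: "G \<in> sets \<mu>"
    unfolding G_def \<mu>_def by (rule sets_rough_isometric_rooted_sets)
  have zero_one: "measure \<mu> G = 0 \<or> measure \<mu> G = 1"
    unfolding \<mu>_def
  proof (rule coins_pair_zero_one)
    show "G \<in> sets (coins \<Otimes>\<^sub>M coins)" using G by (simp add: \<mu>_def)
    show "(a, b) \<in> G \<longleftrightarrow> (a', b') \<in> G"
      if "\<And>i. i \<ge> n \<Longrightarrow> a i = a' i" "\<And>i. i \<ge> n \<Longrightarrow> b i = b' i" for a a' b b' n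
    proof
      assume "(a, b) \<in> G"
      then show "(a', b') \<in> G"
        using rough_isometric_rooted_set_cong[of n a a' b b'] that by (simp add: G_def)
    next
      assume "(a', b') \<in> G"
      then show "(a, b) \<in> G"
        using rough_isometric_rooted_set_cong[of n a' a b' b] that by (simp add: G_def)
    qed
  qed
  interpret \<mu>: prob_space \<mu>
    unfolding \<mu>_def by (intro prob_space_pair prob_space_coins)

  define pos where "pos S = (\<lambda>n. int (Suc n) \<in> S)" for S
  define neg where "neg S = (\<lambda>n. - int (Suc n) \<in> S)" for S
  have split: "real_of_int ` S \<union> {0} = rooted_set (pos S) \<union> uminus ` rooted_set (neg S)" for S
    unfolding pos_def neg_def by (rule insert_zero_int_eq_rooted_sets)
  have inj: "inj (\<lambda>n. int (Suc n))" "inj (\<lambda>n. - int (Suc n))"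
    by (auto simp: inj_def)
  note X = assms(2)[unfolded bernoulli_percolation_Z_def, THEN conjunct1]
    assms(2)[unfolded bernoulli_percolation_Z_def, THEN conjunct2, rule_format]
  note Y = assms(3)[unfolded bernoulli_percolation_Z_def, THEN conjunct1]
    assms(3)[unfolded bernoulli_percolation_Z_def, THEN conjunct2, rule_format]
  note law_P = P.distr_independent_indicators_eq_coins[OF X Y assms(4) _ UNIV_I _ UNIV_I, folded \<mu>_def]
  \<comment> \<open>Right with right and right with left are the two outcomes of
    \<open>rough_isometric_ends\<close>; right with right and left with left are what gluing
    needs.\<close>
  note law_pp = law_P[OF inj(1) inj(1), folded pos_def neg_def]
  note law_pn = law_P[OF inj(1) inj(2), folded pos_def neg_def]
  note law_nn = law_P[OF inj(2) inj(2), folded pos_def neg_def]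

  have law_Q: "(\<lambda>\<omega>. (\<lambda>n. Suc n \<in> A \<omega>, \<lambda>n. Suc n \<in> B \<omega>)) \<in> measurable Q \<mu>"
      "distr Q \<mu> (\<lambda>\<omega>. (\<lambda>n. Suc n \<in> A \<omega>, \<lambda>n. Suc n \<in> B \<omega>)) = \<mu>"
    unfolding \<mu>_def
    by (rule Q.distr_independent_indicators_eq_coins[OF _ _ _ _ assms(8), of "{1..}" "{1..}"];
        use assms(6,7) in \<open>simp add: rooted_bernoulli_percolation_N_def\<close>)+
  have nats: "rooted_set (\<lambda>n. Suc n \<in> S) = real ` S" if "0 \<in> S" for S
  proof -
    have "x = 0 \<or> Suc (x - 1) \<in> S \<longleftrightarrow> x \<in> S" for x
      using that by (cases x) auto
    then show ?thesis unfolding rooted_set_def rooted_nats_def by simp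
  qed
  \<comment> \<open>Both sets contain 0, so a root can be imposed on any rough isometry and the
    event of (ii) is the preimage of \<open>G\<close>, in particular measurable.\<close>
  have "{\<omega> \<in> space Q. rooted_rough_isometric (real ` A \<omega>, 0) (real ` B \<omega>, 0)} =
      (\<lambda>\<omega>. (\<lambda>n. Suc n \<in> A \<omega>, \<lambda>n. Suc n \<in> B \<omega>)) -` G \<inter> space Q"
  proof -
    have "rooted_rough_isometric (real ` A \<omega>, 0) (real ` B \<omega>, 0) \<longleftrightarrow> rough_isometric (real ` A \<omega>) (real ` B \<omega>)"
      if "0 \<in> A \<omega>" "0 \<in> B \<omega>" for \<omega>
      using that rooted_imp_rough_isometric
        rough_isometric_imp_rooted[OF _ coarsely_equal_refl coarsely_equal_refl, of "real ` A \<omega>" "real ` B \<omega>" 0 0]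
      by force
    then show ?thesis
      using assms(6,7) unfolding rooted_bernoulli_percolation_N_def G_def by (auto simp: nats)
  qed
  then have Q_eq: "measure Q {\<omega> \<in> space Q. rooted_rough_isometric (real ` A \<omega>, 0) (real ` B \<omega>, 0)} = measure \<mu> G"
    using measure_distr[OF law_Q(1) G] law_Q(2) by simp

  have "AE \<omega> in P. small_gaps (pos (X \<omega>))" "AE \<omega> in P. small_gaps (pos (Y \<omega>))"
      "AE \<omega> in P. small_gaps (neg (X \<omega>))" "AE \<omega> in P. small_gaps (neg (Y \<omega>))"
    unfolding pos_def neg_def
    using P.AE_small_gaps_indicators[OF X _ UNIV_I] P.AE_small_gaps_indicators[OF Y _ UNIV_I] inj by auto
  then have gaps: "AE \<omega> in P. small_gaps (pos (X \<omega>)) \<and> small_gaps (pos (Y \<omega>)) \<and>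
      small_gaps (neg (X \<omega>)) \<and> small_gaps (neg (Y \<omega>))"
    by eventually_elim auto
  \<comment> \<open>Adding 0 is a bounded change only for a nonempty set.\<close>
  have nonempty: "S \<noteq> {}" if "small_gaps (pos S)" for S
    using that unfolding small_gaps_def pos_def by (metis empty_iff order_refl)
  have insert: "coarsely_equal (real_of_int ` S) (real_of_int ` S \<union> {0})" if "S \<noteq> {}" for S
    using that coarsely_equal_Un_finite[of "{0}" _ "real_of_int ` S"] by blast

  show ?thesis
    unfolding Q_eq
  proof
    assume AE: "AE \<omega> in P. rough_isometric (real_of_int ` X \<omega>) (real_of_int ` Y \<omega>)"
    show "measure \<mu> G > 0"
    proof (rule ccontr)
      assume "\<not> measure \<mu> G > 0"
      then have "measure \<mu> G = 0" using zero_one by auto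
      then have not_G: "AE p in \<mu>. p \<notin> G"
        using G by (simp add: \<mu>.prob_eq_0)
      \<comment> \<open>Each pair has law \<open>\<mu>\<close>, so almost surely both avoid
        \<open>G\<close>, whereas \<open>rough_isometric_ends\<close> puts one of them into
        \<open>G\<close>.\<close>
      have "AE \<omega> in P. (pos (X \<omega>), pos (Y \<omega>)) \<notin> G" "AE \<omega> in P. (pos (X \<omega>), neg (Y \<omega>)) \<notin> G"
        using AE_distrD[OF law_pp(1), unfolded law_pp(2), OF not_G]
          AE_distrD[OF law_pn(1), unfolded law_pn(2), OF not_G] by auto
      then have "AE \<omega> in P. False"
        using AE gaps
      proof eventually_elim
        case (elim \<omega>)
        have "rough_isometric (real_of_int ` X \<omega> \<union> {0}) (real_of_int ` Y \<omega> \<union> {0})"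
          by (rule rough_isometric_coarsely_equal[OF elim(3)]) (use insert nonempty elim(4) in auto)
        then have "rough_isometric (rooted_set (pos (X \<omega>))) (rooted_set (pos (Y \<omega>))) \<or>
            rough_isometric (rooted_set (pos (X \<omega>))) (rooted_set (neg (Y \<omega>)))"
          unfolding split using elim(4) by (intro rough_isometric_ends) auto
        then show ?case using elim(1,2) by (auto simp: G_def)
      qed
      then show False by simp
    qed
  next
    assume "measure \<mu> G > 0"
    \<comment> \<open>The zero-one law raises positive probability to 1, so that the right halves
      and the left halves are simultaneously rough isometric almost surely.\<close>
    then have "measure \<mu> G = 1" using zero_one by auto
    then have in_G: "AE p in \<mu>. p \<in> G" using G by (simp add: \<mu>.prob_eq_1)
    have "AE \<omega> in P. (pos (X \<omega>), pos (Y \<omega>)) \<in> G" "AE \<omega> in P. (neg (X \<omega>), neg (Y \<omega>)) \<in> G"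
      using AE_distrD[OF law_pp(1), unfolded law_pp(2), OF in_G]
        AE_distrD[OF law_nn(1), unfolded law_nn(2), OF in_G] by auto
    then show "AE \<omega> in P. rough_isometric (real_of_int ` X \<omega>) (real_of_int ` Y \<omega>)"
      using gaps
    proof eventually_elim
      case (elim \<omega>)
      have root: "rooted_rough_isometric (rooted_set a, 0) (rooted_set b, 0)" if "(a, b) \<in> G" for a b
        by (rule rough_isometric_imp_rooted[OF _ coarsely_equal_refl coarsely_equal_refl])
          (use that zero_in_rooted_set in \<open>auto simp: G_def\<close>)
      \<comment> \<open>The halves are glued at 0, and the added point is removed
        afterwards.\<close>
      have "rough_isometric (real_of_int ` X \<omega> \<union> {0}) (real_of_int ` Y \<omega> \<union> {0})"
        unfolding split
        by (rule rough_isometric_glue[OF _ _ _ _ _ _ root[OF elim(1)] root[OF elim(2)]])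
          (auto intro: rooted_set_nonneg zero_in_rooted_set)
      then show ?case
        by (rule rough_isometric_coarsely_equal[OF _ coarsely_equal_sym[OF insert] coarsely_equal_sym[OF insert]])
          (use nonempty elim(3) in auto)
    qed
  qed
qed

end
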